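(* Let $G$ be a graph with universal homotopy cover $\rho:U\to G$ (based at a vertex $v$), and let $S\le D(G)$ be a subgroup. Define $r:U/S\to G$ by $r([u])=\rho(u)$. Then $r$ is well defined and is a homotopy covering map.
   Context: All graphs are undirected, have no multiple edges, may have loops, are connected, and are not a single isolated vertex. A walk is a sequence $(v_0\cdots v_n)$ with $v_i\sim v_{i+1}$; $N_2(v)$ is the set of walks of length 2 starting at $v$. A homotopy covering map is a morphism $f:\widetilde G\to G$ such that for every vertex $\tilde v$, applying $f$ vertexwise gives a bijection $N_2(\tilde v)\to N_2(f(\tilde v))$ respecting endpoints (two walks in $N_2(\tilde v)$ end at the same vertex iff their images do). A prune of a walk with $v_i=v_{i+2}$ replaces the segment $v_iv_{i+1}v_i$ by $v_i$; a spider move on $(v_0\cdots v_n)$ replaces one vertex $v_i$, $0<i<n$, by $v_i'$ with $v_{i-1}\sim v_i'\sim v_{i+1}$; walks are equivalent if connected by finitely many prunes, inverse prunes and spider moves. $\Pi(G)$ is the groupoid with objects the vertices and arrows the equivalence classes of walks, composed by concatenation ($\alpha*\beta$ = $\alpha$ then $\beta$); $\Pi_v(G)$ is the set of arrows with source $v$. The universal homotopy cover $U=U_vG$ has vertices the arrows of $\Pi_v(G)$, with $\alpha\sim\beta$ iff $\beta=\alpha*[(wx)]$ for an edge $w\sim x$ with $w$ the target of $\alpha$; $\rho$ sends an arrow to its target. $D(G)$ is the group of graph automorphisms $\varphi$ of $U$ with $\rho\circ\varphi=\rho$. For $S\le D(G)$, $U/S$ is the graph whose vertices are the $S$-orbits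 $[u]$ of vertices of $U$, with $[u]\sim[w]$ iff there are representatives $u,w$ with $u\sim w$ in $U$. *)

theory Defs
  imports
    "HOL-Algebra.Bij"
    "HOL-Algebra.Group_Action"
    "Graph_Theory.Pair_Digraph"
    "Graph_Theory.Digraph_Component"
    "Graph_Theory.Vertex_Walk"
begin

section \<open>Graphs\<close>

text \<open>
  An undirected graph without multiple edges, possibly with loops and possibly infinite, is a
  symmetric pair digraph: \<open>x \<sim> y\<close> is \<open>(x, y) \<in> parcs G\<close>.  The library's \<^const>\<open>connected\<close>
  includes that there is at least one vertex.
\<close>

definition loop_graph :: "'a pair_pre_digraph \<Rightarrow> bool" where
  "loop_graph G \<longleftrightarrow>
     pair_sym_digraph G \<and> connected G \<and> \<not> (\<exists>x. pverts G = {x} \<and> parcs G = {})"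

definition graph_morphism ::
  "'a pair_pre_digraph \<Rightarrow> 'b pair_pre_digraph \<Rightarrow> ('a \<Rightarrow> 'b) \<Rightarrow> bool" where
  "graph_morphism H G f \<longleftrightarrow>
     (\<forall>x\<in>pverts H. f x \<in> pverts G) \<and> (\<forall>x y. (x, y) \<in> parcs H \<longrightarrow> (f x, f y) \<in> parcs G)"

text \<open>Automorphisms are extensional functions, as required by \<^const>\<open>Bij\<close>.\<close>

definition graph_automorphisms :: "'a pair_pre_digraph \<Rightarrow> ('a \<Rightarrow> 'a) set" where
  "graph_automorphisms G =
     {\<phi> \<in> Bij (pverts G).
        \<forall>x\<in>pverts G. \<forall>y\<in>pverts G. (x, y) \<in> parcs G \<longleftrightarrow> (\<phi> x, \<phi> y) \<in> parcs G}"


section \<open>Homotopy covering maps\<close>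

text \<open>A walk is its nonempty list of vertices; \<^const>\<open>vwalk_length\<close> counts edges.\<close>

definition two_walks :: "'a pair_pre_digraph \<Rightarrow> 'a \<Rightarrow> 'a vwalk set" where
  "two_walks G x = {p. vwalk p (with_proj G) \<and> vwalk_length p = 2 \<and> hd p = x}"

definition homotopy_covering_map ::
  "'a pair_pre_digraph \<Rightarrow> 'b pair_pre_digraph \<Rightarrow> ('a \<Rightarrow> 'b) \<Rightarrow> bool" where
  "homotopy_covering_map H G f \<longleftrightarrow>
     loop_graph H \<and> loop_graph G \<and> graph_morphism H G f \<and>
     (\<forall>x\<in>pverts H.
        bij_betw (map f) (two_walks H x) (two_walks G (f x)) \<and>
        (\<forall>p\<in>two_walks H x. \<forall>q\<in>two_walks H x.
           last p = last q \<longleftrightarrow> last (map f p) = last (map f q)))"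


section \<open>The fundamental groupoid\<close>

inductive walk_move :: "'a pair_pre_digraph \<Rightarrow> 'a vwalk \<Rightarrow> 'a vwalk \<Rightarrow> bool"
  for G :: "'a pair_pre_digraph" where
  prune: "vwalk (p @ [x, y, x] @ q) (with_proj G) \<Longrightarrow>
    walk_move G (p @ [x, y, x] @ q) (p @ [x] @ q)"
| spider: "vwalk (p @ [x, y, z] @ q) (with_proj G) \<Longrightarrow>
    (x, y') \<in> parcs G \<Longrightarrow> (y', z) \<in> parcs G \<Longrightarrow>
    walk_move G (p @ [x, y, z] @ q) (p @ [x, y', z] @ q)"

definition walk_htpy :: "'a pair_pre_digraph \<Rightarrow> 'a vwalk rel" where
  "walk_htpy G =
     {(p, q). vwalk p (with_proj G) \<and> vwalk q (with_proj G) \<and> equivclp (walk_move G) p q}"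

definition walk_class :: "'a pair_pre_digraph \<Rightarrow> 'a vwalk \<Rightarrow> 'a vwalk set" where
  "walk_class G p = walk_htpy G `` {p}"

definition arrows :: "'a pair_pre_digraph \<Rightarrow> 'a vwalk set set" where
  "arrows G = {p. vwalk p (with_proj G)} // walk_htpy G"

text \<open>
  Moves fix both endpoints of a walk, so the sets under \<^const>\<open>the_elem\<close> are singletons
  whenever \<open>\<alpha> \<in> arrows G\<close>.
\<close>

definition arrow_source :: "'a vwalk set \<Rightarrow> 'a" where
  "arrow_source \<alpha> = the_elem (hd ` \<alpha>)"

definition arrow_target :: "'a vwalk set \<Rightarrow> 'a" where
  "arrow_target \<alpha> = the_elem (last ` \<alpha>)"

text \<open>
  Composition of classes, first \<open>\<alpha>\<close> and then \<open>\<beta>\<close>, meant for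
  \<open>arrow_target \<alpha> = arrow_source \<beta>\<close>.  Since homotopy is compatible with
  concatenation, all classes in the union coincide.
\<close>

definition arrow_comp ::
  "'a pair_pre_digraph \<Rightarrow> 'a vwalk set \<Rightarrow> 'a vwalk set \<Rightarrow> 'a vwalk set" where
  "arrow_comp G \<alpha> \<beta> = (\<Union>p\<in>\<alpha>. \<Union>q\<in>\<beta>. walk_class G (vwalk_join p q))"

definition arrows_from :: "'a pair_pre_digraph \<Rightarrow> 'a \<Rightarrow> 'a vwalk set set" where
  "arrows_from G v = {\<alpha> \<in> arrows G. arrow_source \<alpha> = v}"


section \<open>The universal homotopy cover and its quotients\<close>

definition universal_cover ::
  "'a pair_pre_digraph \<Rightarrow> 'a \<Rightarrow> 'a vwalk set pair_pre_digraph" where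
  "universal_cover G v =
     \<lparr>pverts = arrows_from G v,
      parcs = {(\<alpha>, \<beta>). \<alpha> \<in> arrows_from G v \<and> \<beta> \<in> arrows_from G v \<and>
        (\<exists>w x. w = arrow_target \<alpha> \<and> (w, x) \<in> parcs G \<and>
           \<beta> = arrow_comp G \<alpha> (walk_class G [w, x]))}\<rparr>"

abbreviation cover_proj :: "'a vwalk set \<Rightarrow> 'a" where
  "cover_proj \<equiv> arrow_target"

definition deck_group ::
  "'a pair_pre_digraph \<Rightarrow> 'a \<Rightarrow> ('a vwalk set \<Rightarrow> 'a vwalk set) monoid" where
  "deck_group G v =
     (BijGroup (pverts (universal_cover G v)))
       \<lparr>carrier := {\<phi> \<in> graph_automorphisms (universal_cover G v).
          \<forall>u\<in>pverts (universal_cover G v). cover_proj (\<phi> u) = cover_proj u}\<rparr>"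

text \<open>
  \<open>cover_orbit G v S u\<close> is the vertex \<open>[u]\<close> of \<open>U/S\<close>, the orbit of \<open>u\<close> under the evaluation
  action of \<open>S\<close>.
\<close>

definition cover_orbit ::
  "'a pair_pre_digraph \<Rightarrow> 'a \<Rightarrow> ('a vwalk set \<Rightarrow> 'a vwalk set) set \<Rightarrow>
   'a vwalk set \<Rightarrow> 'a vwalk set set" where
  "cover_orbit G v S u = orbit ((deck_group G v)\<lparr>carrier := S\<rparr>) (\<lambda>\<phi>. \<phi>) u"

definition cover_quotient ::
  "'a pair_pre_digraph \<Rightarrow> 'a \<Rightarrow> ('a vwalk set \<Rightarrow> 'a vwalk set) set \<Rightarrow>
   'a vwalk set set pair_pre_digraph" where
  "cover_quotient G v S =
     \<lparr>pverts = cover_orbit G v S ` pverts (universal_cover G v),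
      parcs = {(X, Y).
        X \<in> cover_orbit G v S ` pverts (universal_cover G v) \<and>
        Y \<in> cover_orbit G v S ` pverts (universal_cover G v) \<and>
        (\<exists>u\<in>X. \<exists>w\<in>Y. (u, w) \<in> parcs (universal_cover G v))}\<rparr>"

text \<open>
  The common value of the projection on an orbit; that there is one is the
  well-definedness of \<open>r\<close>.
\<close>

definition quotient_proj :: "'a vwalk set set \<Rightarrow> 'a" where
  "quotient_proj X = the_elem (cover_proj ` X)"

end

theory Submission
  imports Defs
begin

text \<open>
  The neighbours of the class of a walk \<open>p\<close> in \<open>U\<close> are the classes of \<open>p\<close> followed by
  one edge, so \<open>\<rho>\<close> is bijective on neighbourhoods; a spider move shows that two walks of length
  2 from one vertex of \<open>U\<close> end at the same vertex as soon as their images do.  Since \<open>S\<close> acts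
  by automorphisms over \<open>G\<close>, every arc of \<open>U/S\<close> leaving \<open>[u]\<close> lifts to an arc of \<open>U\<close>
  leaving \<open>u\<close> itself.  Hence both properties pass from \<open>\<rho>\<close> to \<open>r\<close>.
\<close>

section \<open>Walks and homotopy\<close>

lemma vwalk_append_iff:
  assumes "p \<noteq> []" "q \<noteq> []"
  shows "vwalk (p @ q) H \<longleftrightarrow> vwalk p H \<and> vwalk q H \<and> (last p, hd q) \<in> arcs_ends H"
  using assms by (auto simp: vwalk_def vwalk_arcs_append)

context pair_sym_digraph
begin

lemma vwalk_snoc_iff:
  assumes "p \<noteq> []"
  shows "vwalk (p @ [x]) (with_proj G) \<longleftrightarrow> vwalk p (with_proj G) \<and> (last p, x) \<in> parcs G"
  using assms by (auto simp: vwalk_append_iff) (auto simp: vwalk_def dest: in_arcsD2)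

lemma vwalk_Cons_Cons_iff:
  "vwalk (x # y # p) (with_proj G) \<longleftrightarrow> (x, y) \<in> parcs G \<and> vwalk (y # p) (with_proj G)"
  by (auto simp: vwalk_def dest: in_arcsD1)

lemma vwalk_nonempty: "vwalk p (with_proj G) \<Longrightarrow> p \<noteq> []"
  by (simp add: vwalk_def)

section \<open>Moves and homotopy: endpoints and concatenation\<close>

lemma walk_move_hd_last:
  assumes "walk_move G p q"
  shows "hd q = hd p" "last q = last p"
  using assms by (induction rule: walk_move.induct) (auto simp: hd_append)

text \<open>The rules of \<open>walk_move\<close> demand a walk only on the left. The right side is
  one too: after a prune the remaining \<open>x\<close> inherits one neighbour from each old copy,
  and the new middle vertex of a spider move is adjacent to both sides.\<close>

lemma walk_move_vwalk:
  assumes "walk_move G p q"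
  shows "vwalk p (with_proj G)" "vwalk q (with_proj G)"
proof -
  have step: "vwalk p (with_proj G) \<and> vwalk q (with_proj G)" if "walk_move G p q" for p q
    using that
  proof (induction rule: walk_move.induct)
    case (prune p x y q)
    then show ?case
      by (cases "p = []"; cases "q = []")
        (auto simp: vwalk_append_iff vwalk_Cons_Cons_iff)
  next
    case (spider p x y z q y')
    then show ?case
      by (cases "p = []"; cases "q = []")
        (auto simp: vwalk_append_iff vwalk_Cons_Cons_iff)
  qed
  show "vwalk p (with_proj G)" "vwalk q (with_proj G)"
    using step[OF assms] by auto
qed

text \<open>A move is local: the context \<open>a\<close>, \<open>b\<close> is absorbed into the
  parts of the walk that the rule leaves untouched.\<close>

lemma walk_move_append:
  assumes "walk_move G p q" "vwalk (a @ p @ b) (with_proj G)"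
  shows "walk_move G (a @ p @ b) (a @ q @ b)"
  using assms
proof (induction rule: walk_move.induct)
  case (prune p x y q)
  then show ?case
    using walk_move.prune[of "a @ p" x y "q @ b" G] by simp
next
  case (spider p x y z q y')
  then show ?case
    using walk_move.spider[of "a @ p" x y z "q @ b" G y'] by simp
qed

lemma walk_htpy_move: "walk_move G p q \<Longrightarrow> (p, q) \<in> walk_htpy G"
  by (auto simp: walk_htpy_def dest: walk_move_vwalk)

lemma equiv_walk_htpy: "equiv {p. vwalk p (with_proj G)} (walk_htpy G)"
  by (auto simp: equiv_def refl_on_def walk_htpy_def sym_def trans_def
      intro: equivclp_sym equivclp_trans)

text \<open>Each move fixes both endpoints, hence so does a chain of moves. This makes source and
  target of an arrow independent of the representative.\<close>

lemma walk_htpy_hd_last: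
  assumes "(p, q) \<in> walk_htpy G"
  shows "hd q = hd p" "last q = last p"
proof -
  have "equivclp (walk_move G) p q"
    using assms by (simp add: walk_htpy_def)
  then have "hd q = hd p \<and> last q = last p"
    by (induction rule: equivclp_induct) (auto dest: walk_move_hd_last)
  then show "hd q = hd p" "last q = last p" by auto
qed

text \<open>Every move of the chain from \<open>p\<close> to \<open>q\<close> can be carried out
  inside the context. This congruence property underlies composition of classes.\<close>

lemma walk_htpy_append:
  assumes "(p, q) \<in> walk_htpy G" "vwalk (a @ p @ b) (with_proj G)"
  shows "(a @ p @ b, a @ q @ b) \<in> walk_htpy G"
proof -
  have "equivclp (walk_move G) p q"
    using assms by (simp add: walk_htpy_def)
  then show ?thesis
  proof (induction rule: equivclp_induct)
    case base
    then show ?case using assms(2) by (simp add: walk_htpy_def)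
  next
    case (step y z)
    then have y: "vwalk (a @ y @ b) (with_proj G)"
      by (simp add: walk_htpy_def)
    \<comment> \<open>Since \<open>z\<close> is a walk with the endpoints of \<open>y\<close>, it
      fits between \<open>a\<close> and \<open>b\<close> as \<open>y\<close> does.\<close>
    have z: "vwalk (a @ z @ b) (with_proj G)"
    proof -
      have "vwalk z (with_proj G)" "vwalk y (with_proj G)" "hd z = hd y" "last z = last y"
        using step.hyps(2) by (auto dest: walk_move_vwalk walk_move_hd_last)
      then show ?thesis
        using y vwalk_nonempty[of y] vwalk_nonempty[of z]
        by (cases "a = []"; cases "b = []") (auto simp: vwalk_append_iff hd_append)
    qed
    \<comment> \<open>A link of the chain may be a move read backwards, hence two cases.\<close>
    have "walk_move G (a @ y @ b) (a @ z @ b) \<or> walk_move G (a @ z @ b) (a @ y @ b)"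
      using step.hyps(2) walk_move_append y z by blast
    then have "equivclp (walk_move G) (a @ y @ b) (a @ z @ b)" by blast
    with step.IH z show ?case
      by (auto simp: walk_htpy_def intro: equivclp_trans)
  qed
qed

section \<open>Classes of walks: endpoints, composition with an edge, prune and spider
  identities\<close>

lemma walk_class_eq_iff:
  assumes "vwalk p (with_proj G)" "vwalk q (with_proj G)"
  shows "walk_class G p = walk_class G q \<longleftrightarrow> (p, q) \<in> walk_htpy G"
  using assms equiv_walk_htpy unfolding walk_class_def by (simp add: eq_equiv_class_iff)

lemma walk_class_self: "vwalk p (with_proj G) \<Longrightarrow> p \<in> walk_class G p"
  by (simp add: walk_class_def walk_htpy_def)

lemma arrow_target_walk_class:
  assumes "vwalk p (with_proj G)"
  shows "arrow_target (walk_class G p) = last p"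
proof -
  have "last ` walk_class G p = {last p}"
    using walk_class_self[OF assms] by (auto simp: walk_class_def dest: walk_htpy_hd_last)
  then show ?thesis by (simp add: arrow_target_def)
qed

lemma arrow_source_walk_class:
  assumes "vwalk p (with_proj G)"
  shows "arrow_source (walk_class G p) = hd p"
proof -
  have "hd ` walk_class G p = {hd p}"
    using walk_class_self[OF assms] by (auto simp: walk_class_def dest: walk_htpy_hd_last)
  then show ?thesis by (simp add: arrow_source_def)
qed

text \<open>Whatever representatives are joined, \<open>p\<close> can be deformed to
  \<open>p'\<close> first and the final edge to \<open>q'\<close> afterwards, so all classes in the
  union agree. Composition with an edge thereby becomes appending a vertex.\<close>

lemma arrow_comp_edge:
  assumes p: "vwalk p (with_proj G)" and x: "(last p, x) \<in> parcs G"
  shows "arrow_comp G (walk_class G p) (walk_class G [last p, x]) = walk_class G (p @ [x])"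
proof -
  have px: "vwalk (p @ [x]) (with_proj G)"
    using p x by (simp add: vwalk_snoc_iff vwalk_nonempty)
  have e: "vwalk [last p, x] (with_proj G)"
    using x by (simp add: vwalk_def wellformed')
  have "walk_class G (vwalk_join p' q') = walk_class G (p @ [x])"
    if p': "p' \<in> walk_class G p" and q': "q' \<in> walk_class G [last p, x]" for p' q'
  proof -
    have pp: "(p, p') \<in> walk_htpy G" and qq: "([last p, x], q') \<in> walk_htpy G"
      using p' q' by (auto simp: walk_class_def)
    have 1: "(p @ [x], p' @ [x]) \<in> walk_htpy G"
      using walk_htpy_append[OF pp, of "[]" "[x]"] px by simp
    then have vp': "vwalk (p' @ [x]) (with_proj G)" by (simp add: walk_htpy_def)
    have ne: "p' \<noteq> []" "q' \<noteq> []"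
      using pp qq by (auto simp: walk_htpy_def vwalk_def)
    have l: "last p' = last p" "hd q' = last p"
      using walk_htpy_hd_last[OF pp] walk_htpy_hd_last[OF qq] by auto
    \<comment> \<open>The join keeps only one copy of the common vertex \<open>last p\<close>.
      Splitting it off \<open>p'\<close> exposes the edge as a block of \<open>p' @ [x]\<close> that
      can be exchanged for \<open>q'\<close>.\<close>
    obtain a where a: "p' = a @ [last p]"
      using ne(1) l(1) by (metis append_butlast_last_id)
    moreover obtain b where "q' = last p # b"
      using ne(2) l(2) by (cases q') auto
    ultimately have eq: "p' @ [x] = a @ [last p, x] @ []" "vwalk_join p' q' = a @ q' @ []"
      by (simp_all add: vwalk_join_def)
    have 2: "(p' @ [x], vwalk_join p' q') \<in> walk_htpy G"
      unfolding eq using vp' unfolding eq by (rule walk_htpy_append[OF qq])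
    then have "vwalk (vwalk_join p' q') (with_proj G)" by (simp add: walk_htpy_def)
    with 1 2 px vp' show ?thesis
      by (simp add: walk_class_eq_iff[symmetric])
  qed
  \<comment> \<open>A union of a constant family is that constant only if the index sets are
    nonempty.\<close>
  moreover have "walk_class G p \<noteq> {}" "walk_class G [last p, x] \<noteq> {}"
    using walk_class_self[OF p] walk_class_self[OF e] by blast+
  ultimately show ?thesis
    by (simp add: arrow_comp_def cong: SUP_cong)
qed

text \<open>Going along an edge and back is undone by a prune at the end of the walk. This yields
  symmetry of adjacency in the cover.\<close>

lemma walk_class_prune:
  assumes "vwalk p (with_proj G)" "(last p, x) \<in> parcs G"
  shows "walk_class G (p @ [x, last p]) = walk_class G p"
proof -
  have w: "vwalk (p @ [x, last p]) (with_proj G)"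
    using assms vwalk_snoc_iff[of "p @ [x]" "last p"]
    by (simp add: vwalk_snoc_iff vwalk_nonempty arcs_symmetric)
  obtain a y where p: "p = a @ [y]"
    using vwalk_nonempty[OF assms(1)] by (metis append_butlast_last_id)
  then have "walk_move G (p @ [x, last p]) p"
    using w walk_move.prune[of a y x "[]" G] by simp
  with w assms(1) walk_htpy_move show ?thesis
    by (simp add: walk_class_eq_iff)
qed

text \<open>The vertex \<open>x\<close> is interior, so a spider move replaces it by
  \<open>x'\<close>. This identifies the ends of two-step continuations in the cover.\<close>

lemma walk_class_spider:
  assumes p: "vwalk p (with_proj G)" and x: "(last p, x) \<in> parcs G" "(x, z) \<in> parcs G"
    and x': "(last p, x') \<in> parcs G" "(x', z) \<in> parcs G"
  shows "walk_class G (p @ [x, z]) = walk_class G (p @ [x', z])"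
proof -
  have w: "vwalk (p @ [y, z]) (with_proj G)"
    if "(last p, y) \<in> parcs G" "(y, z) \<in> parcs G" for y
    using that p vwalk_snoc_iff[of "p @ [y]" z] by (simp add: vwalk_snoc_iff vwalk_nonempty)
  obtain a y where "p = a @ [y]"
    using vwalk_nonempty[OF p] by (metis append_butlast_last_id)
  then have "walk_move G (p @ [x, z]) (p @ [x', z])"
    using w[OF x] x' walk_move.spider[of a y x z "[]" G x'] by simp
  with w[OF x] w[OF x'] walk_htpy_move show ?thesis
    by (simp add: walk_class_eq_iff)
qed

section \<open>The universal cover\<close>

lemma pverts_universal_cover:
  "pverts (universal_cover G v) = walk_class G ` {p. vwalk p (with_proj G) \<and> hd p = v}"
  by (auto simp: universal_cover_def arrows_from_def arrows_def quotient_def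
      arrow_source_walk_class walk_class_def[symmetric])

text \<open>Working form of adjacency in the cover: with a representative \<open>p\<close> fixed,
  composition of classes is replaced by extension of \<open>p\<close>.\<close>

lemma universal_cover_arc_iff:
  assumes "vwalk p (with_proj G)" "hd p = v"
  shows "(walk_class G p, \<beta>) \<in> parcs (universal_cover G v) \<longleftrightarrow>
    (\<exists>x. (last p, x) \<in> parcs G \<and> \<beta> = walk_class G (p @ [x]))"
proof -
  have "walk_class G (p @ [x]) \<in> pverts (universal_cover G v)" if "(last p, x) \<in> parcs G" for x
    using that assms vwalk_nonempty[of p]
    by (auto simp: pverts_universal_cover vwalk_snoc_iff)
  moreover have "walk_class G p \<in> pverts (universal_cover G v)"
    using assms by (auto simp: pverts_universal_cover)
  moreover have "pverts (universal_cover G v) = arrows_from G v"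
    by (simp add: universal_cover_def)
  ultimately show ?thesis
    using assms by (auto simp: universal_cover_def arrow_target_walk_class arrow_comp_edge)
qed

lemma pair_sym_digraph_universal_cover: "pair_sym_digraph (universal_cover G v)"
proof unfold_locales
  show "fst e \<in> pverts (universal_cover G v)" "snd e \<in> pverts (universal_cover G v)"
    if "e \<in> parcs (universal_cover G v)" for e
    using that by (auto simp: universal_cover_def)
  have "(\<beta>, \<alpha>) \<in> parcs (universal_cover G v)"
    if arc: "(\<alpha>, \<beta>) \<in> parcs (universal_cover G v)" for \<alpha> \<beta>
  proof -
    have "\<alpha> \<in> pverts (universal_cover G v)"
      using arc by (simp add: universal_cover_def)
    then obtain p where p: "vwalk p (with_proj G)" "hd p = v" "\<alpha> = walk_class G p"
      by (auto simp: pverts_universal_cover)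
    then obtain x where x: "(last p, x) \<in> parcs G" "\<beta> = walk_class G (p @ [x])"
      using arc universal_cover_arc_iff by auto
    have px: "vwalk (p @ [x]) (with_proj G)" "hd (p @ [x]) = v"
      using p x vwalk_nonempty[of p] by (auto simp: vwalk_snoc_iff)
    \<comment> \<open>Traversing the new edge backwards leads to \<open>\<alpha>\<close> again, by
      pruning.\<close>
    have "(last (p @ [x]), last p) \<in> parcs G \<and> \<alpha> = walk_class G ((p @ [x]) @ [last p])"
      using p(1,3) x(1) by (simp add: arcs_symmetric walk_class_prune)
    then show ?thesis
      using universal_cover_arc_iff[OF px] x(2) by auto
  qed
  then show "symmetric (with_proj (universal_cover G v))"
    by (auto simp: symmetric_def sym_def)
qed

section \<open>Local structure of the projection of the universal cover\<close>

lemma graph_morphism_cover_proj: "graph_morphism (universal_cover G v) G cover_proj"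
  unfolding graph_morphism_def
proof (intro conjI ballI allI impI)
  fix \<alpha> assume "\<alpha> \<in> pverts (universal_cover G v)"
  then show "cover_proj \<alpha> \<in> pverts G"
    by (auto simp: pverts_universal_cover arrow_target_walk_class) (auto simp: vwalk_def)
next
  fix \<alpha> \<beta> assume arc: "(\<alpha>, \<beta>) \<in> parcs (universal_cover G v)"
  then have "\<alpha> \<in> pverts (universal_cover G v)"
    by (simp add: universal_cover_def)
  then obtain p where p: "vwalk p (with_proj G)" "hd p = v" "\<alpha> = walk_class G p"
    by (auto simp: pverts_universal_cover)
  then show "(cover_proj \<alpha>, cover_proj \<beta>) \<in> parcs G"
    using arc vwalk_nonempty[of p]
    by (auto simp: universal_cover_arc_iff arrow_target_walk_class vwalk_snoc_iff)
qed

text \<open>The lift is obtained by appending \<open>x\<close> to a representative of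
  \<open>\<alpha>\<close>.\<close>

lemma cover_proj_lift:
  assumes "\<alpha> \<in> pverts (universal_cover G v)" "(cover_proj \<alpha>, x) \<in> parcs G"
  shows "\<exists>\<beta>. (\<alpha>, \<beta>) \<in> parcs (universal_cover G v) \<and> cover_proj \<beta> = x"
proof -
  obtain p where p: "vwalk p (with_proj G)" "hd p = v" "\<alpha> = walk_class G p"
    using assms(1) by (auto simp: pverts_universal_cover)
  then have x: "(last p, x) \<in> parcs G"
    using assms(2) by (simp add: arrow_target_walk_class)
  then have "cover_proj (walk_class G (p @ [x])) = x"
    using p vwalk_nonempty[of p] by (simp add: arrow_target_walk_class vwalk_snoc_iff)
  with p x show ?thesis
    by (auto simp: universal_cover_arc_iff)
qed

text \<open>A neighbour of the class of \<open>p\<close> is determined by the appended vertex, and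
  that vertex is its projection.\<close>

lemma cover_proj_inj_neighbours:
  assumes "(\<alpha>, \<beta>) \<in> parcs (universal_cover G v)" "(\<alpha>, \<beta>') \<in> parcs (universal_cover G v)"
    and "cover_proj \<beta> = cover_proj \<beta>'"
  shows "\<beta> = \<beta>'"
proof -
  have "\<alpha> \<in> pverts (universal_cover G v)"
    using assms(1) by (simp add: universal_cover_def)
  then obtain p where p: "vwalk p (with_proj G)" "hd p = v" "\<alpha> = walk_class G p"
    by (auto simp: pverts_universal_cover)
  then show ?thesis
    using assms vwalk_nonempty[of p]
    by (auto simp: universal_cover_arc_iff arrow_target_walk_class vwalk_snoc_iff)
qed

text \<open>Both ends are classes of one walk \<open>p\<close> extended by two edges to the same
  final vertex; only the middle vertices may differ, and a spider move exchanges them.\<close>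

lemma cover_proj_inj_two_steps:
  assumes "(\<alpha>, \<beta>) \<in> parcs (universal_cover G v)" "(\<beta>, \<gamma>) \<in> parcs (universal_cover G v)"
    and "(\<alpha>, \<beta>') \<in> parcs (universal_cover G v)" "(\<beta>', \<gamma>') \<in> parcs (universal_cover G v)"
    and "cover_proj \<gamma> = cover_proj \<gamma>'"
  shows "\<gamma> = \<gamma>'"
proof -
  have "\<alpha> \<in> pverts (universal_cover G v)"
    using assms(1) by (simp add: universal_cover_def)
  then obtain p where p: "vwalk p (with_proj G)" "hd p = v" "\<alpha> = walk_class G p"
    by (auto simp: pverts_universal_cover)
  have two_steps: "\<exists>x z. (last p, x) \<in> parcs G \<and> (x, z) \<in> parcs G \<and>
      \<delta>' = walk_class G (p @ [x, z]) \<and> cover_proj \<delta>' = z"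
    if \<delta>: "(\<alpha>, \<delta>) \<in> parcs (universal_cover G v)"
      and \<delta>': "(\<delta>, \<delta>') \<in> parcs (universal_cover G v)" for \<delta> \<delta>'
  proof -
    obtain x where x: "(last p, x) \<in> parcs G" "\<delta> = walk_class G (p @ [x])"
      using \<delta> p(3) universal_cover_arc_iff[OF p(1,2)] by auto
    have px: "vwalk (p @ [x]) (with_proj G)" "hd (p @ [x]) = v"
      using p x vwalk_nonempty[of p] by (auto simp: vwalk_snoc_iff)
    then obtain z where z: "(x, z) \<in> parcs G" "\<delta>' = walk_class G ((p @ [x]) @ [z])"
      using \<delta>' x universal_cover_arc_iff[OF px] by auto
    then have "vwalk ((p @ [x]) @ [z]) (with_proj G)"
      using px vwalk_snoc_iff[of "p @ [x]" z] by simp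
    then have "cover_proj \<delta>' = z"
      using z by (metis arrow_target_walk_class last_snoc)
    with x z show ?thesis by auto
  qed
  show ?thesis
    using two_steps[OF assms(1,2)] two_steps[OF assms(3,4)] assms(5) walk_class_spider[OF p(1)]
    by metis
qed

section \<open>Connectedness of the universal cover and of images\<close>

lemma connected_if_reachable_from:
  assumes "r \<in> pverts G" "\<And>u. u \<in> pverts G \<Longrightarrow> r \<rightarrow>\<^sup>*\<^bsub>with_proj G\<^esub> u"
  shows "connected (with_proj G)"
  unfolding connected_def
proof (rule strongly_connectedI)
  fix u w assume "u \<in> verts (with_proj (mk_symmetric (with_proj G)))"
    and "w \<in> verts (with_proj (mk_symmetric (with_proj G)))"
  then have "r \<rightarrow>\<^sup>*\<^bsub>with_proj G\<^esub> u" "r \<rightarrow>\<^sup>*\<^bsub>with_proj G\<^esub> w"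
    using assms(2) by auto
  \<comment> \<open>Arcs are symmetric, so the path from \<open>r\<close> to \<open>u\<close> can be
    reversed and continued to \<open>w\<close>.\<close>
  then have "u \<rightarrow>\<^sup>*\<^bsub>with_proj G\<^esub> w"
    by (blast intro: symmetric_reachable' reachable_trans)
  then show "u \<rightarrow>\<^sup>*\<^bsub>with_proj (mk_symmetric (with_proj G))\<^esub> w"
    by (rule reachable_mk_symmetricI)
qed (use assms(1) in auto)

text \<open>The classes of the nonempty initial segments of \<open>p\<close> trace a path in the
  cover from the class of the trivial walk \<open>[v]\<close> to that of \<open>p\<close>.\<close>

lemma connected_universal_cover:
  assumes "v \<in> pverts G"
  shows "connected (with_proj (universal_cover G v))"
proof -
  interpret U: pair_sym_digraph "universal_cover G v"
    by (rule pair_sym_digraph_universal_cover)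
  let ?reach = "\<lambda>\<alpha>. walk_class G [v] \<rightarrow>\<^sup>*\<^bsub>with_proj (universal_cover G v)\<^esub> \<alpha>"
  have root: "walk_class G [v] \<in> pverts (universal_cover G v)"
    using assms by (auto simp: pverts_universal_cover vwalk_def)
  have "?reach (walk_class G p)" if "vwalk p (with_proj G)" "hd p = v" for p
    using that
  proof (induction p rule: rev_induct)
    case Nil
    then show ?case by (simp add: vwalk_def)
  next
    case (snoc x p)
    show ?case
    \<comment> \<open>The list \<open>[x]\<close> is the true base case, where the condition on the
      head forces \<open>x = v\<close>.\<close>
    proof (cases "p = []")
      case True
      then show ?thesis using snoc.prems root by simp
    next
      case False
      then have p: "vwalk p (with_proj G)" "hd p = v" "(last p, x) \<in> parcs G"
        using snoc.prems by (auto simp: vwalk_snoc_iff)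
      then have "(walk_class G p, walk_class G (p @ [x])) \<in> parcs (universal_cover G v)"
        by (auto simp: universal_cover_arc_iff)
      with snoc.IH p show ?thesis
        by (metis U.reachable_adj_trans)
    qed
  qed
  with root show ?thesis
    by (intro U.connected_if_reachable_from) (auto simp: pverts_universal_cover)
qed

end

text \<open>Morphisms carry undirected paths to undirected paths, and surjectivity supplies
  preimages of any two vertices. It is applied to the orbit map onto the quotient.\<close>

lemma connected_surjective_image:
  assumes "connected (with_proj H)" "graph_morphism H G f" "f ` pverts H = pverts G"
  shows "connected (with_proj G)"
proof -
  have "(f u, f w) \<in> rtrancl_on (pverts G) ((parcs G)\<^sup>s)"
    if "(u, w) \<in> rtrancl_on (pverts H) ((parcs H)\<^sup>s)" for u w
    using that
  proof (induction rule: rtrancl_on_induct)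
    case base
    then show ?case using assms(3) by auto
  next
    case (step x y)
    then have "(f x, f y) \<in> (parcs G)\<^sup>s" "f y \<in> pverts G"
      using assms(2,3) by (auto simp: graph_morphism_def simp: symcl_def)
    with step.IH show ?case by (rule rtrancl_on_into_rtrancl_on)
  qed
  with assms(1) have "(f u, f w) \<in> rtrancl_on (pverts G) ((parcs G)\<^sup>s)"
    if "u \<in> pverts H" "w \<in> pverts H" for u w
    using that by (simp add: connected_conv)
  moreover have "pverts H \<noteq> {}"
    using assms(1) by (simp add: connected_conv)
  ultimately show ?thesis
    unfolding connected_conv with_proj_simps assms(3)[symmetric] by blast
qed

section \<open>Homotopy covering maps\<close>

lemma two_walks_eq:
  assumes "pair_sym_digraph G"
  shows "two_walks G x = {[x, y, z] |y z. (x, y) \<in> parcs G \<and> (y, z) \<in> parcs G}"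
proof -
  interpret pair_sym_digraph G by fact
  \<comment> \<open>Length counts edges, so two edges mean three vertices.\<close>
  have "length p - 1 = 2 \<longleftrightarrow> (\<exists>a b c. p = [a, b, c])" for p :: "'a list"
    by (cases p; cases "tl p"; cases "tl (tl p)") auto
  then show ?thesis
    by (auto simp: two_walks_def vwalk_Cons_Cons_iff) (auto simp: vwalk_def dest: in_arcsD2)
qed

text \<open>Bijectivity on neighbourhoods suffices for bijectivity on walks of length 2:
  \<open>lift\<close> and \<open>inj\<close> are applied at the first vertex and again at the middle
  one. Only \<open>ends\<close> concerns two steps at once.\<close>

lemma homotopy_covering_mapI:
  assumes H: "loop_graph H" and G: "loop_graph G" and f: "graph_morphism H G f"
    and lift: "\<And>u x. u \<in> pverts H \<Longrightarrow> (f u, x) \<in> parcs G \<Longrightarrow> \<exists>w. (u, w) \<in> parcs H \<and> f w = x"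
    and inj: "\<And>u w w'. (u, w) \<in> parcs H \<Longrightarrow> (u, w') \<in> parcs H \<Longrightarrow> f w = f w' \<Longrightarrow> w = w'"
    and ends: "\<And>u w z w' z'. (u, w) \<in> parcs H \<Longrightarrow> (w, z) \<in> parcs H \<Longrightarrow> (u, w') \<in> parcs H \<Longrightarrow>
      (w', z') \<in> parcs H \<Longrightarrow> f z = f z' \<Longrightarrow> z = z'"
  shows "homotopy_covering_map H G f"
  unfolding homotopy_covering_map_def
proof (intro conjI ballI H G f)
  have wf: "pair_sym_digraph H" "pair_sym_digraph G"
    using H G by (auto simp: loop_graph_def)
  interpret H: pair_sym_digraph H by (fact wf)
  fix u assume u: "u \<in> pverts H"
  have "inj_on (map f) (two_walks H u)"
    using inj by (auto simp: inj_on_def two_walks_eq[OF wf(1)]) blast+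
  moreover have "map f ` two_walks H u = two_walks G (f u)"
  proof (intro equalityI subsetI)
    fix p assume "p \<in> map f ` two_walks H u"
    then show "p \<in> two_walks G (f u)"
      using f by (auto simp: two_walks_eq[OF wf(1)] two_walks_eq[OF wf(2)] graph_morphism_def)
  next
    fix p assume "p \<in> two_walks G (f u)"
    then obtain x y where p: "p = [f u, x, y]" "(f u, x) \<in> parcs G" "(x, y) \<in> parcs G"
      by (auto simp: two_walks_eq[OF wf(2)])
    then obtain w where w: "(u, w) \<in> parcs H" "f w = x" using lift u by blast
    then obtain z where z: "(w, z) \<in> parcs H" "f z = y" using lift H.in_arcsD2 p(3) by blast
    have "[u, w, z] \<in> two_walks H u" "p = map f [u, w, z]"
      using p w z by (auto simp: two_walks_eq[OF wf(1)])
    then show "p \<in> map f ` two_walks H u" by blast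
  qed
  ultimately show "bij_betw (map f) (two_walks H u) (two_walks G (f u))"
    by (simp add: bij_betw_def)
  fix p q assume "p \<in> two_walks H u" "q \<in> two_walks H u"
  then show "(last p = last q) = (last (map f p) = last (map f q))"
    using ends by (auto simp: two_walks_eq[OF wf(1)])
qed

text \<open>If there is another vertex, a path to it has a first edge; if not, \<open>v\<close>
  carries a loop because an isolated vertex is excluded.\<close>

lemma loop_graph_has_neighbour:
  assumes "loop_graph G" "v \<in> pverts G"
  shows "\<exists>x. (v, x) \<in> parcs G"
proof -
  interpret pair_sym_digraph G using assms(1) by (simp add: loop_graph_def)
  have sc: "strongly_connected (with_proj G)"
    using assms(1) sym_arcs by (auto simp: loop_graph_def intro: symmetric_connected_imp_strongly_connected)
  show ?thesis
  proof (cases "pverts G = {v}")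
    case True
    then have "parcs G \<noteq> {}" using assms(1) by (auto simp: loop_graph_def)
    with True show ?thesis by (auto dest: wellformed')
  next
    case False
    then obtain u where u: "u \<in> pverts G" "u \<noteq> v" using assms(2) by blast
    then have "v \<rightarrow>\<^sup>*\<^bsub>with_proj G\<^esub> u" using sc assms(2) by (auto simp: strongly_connected_def)
    then show ?thesis using u(2) by (cases rule: converse_reachable_cases) auto
  qed
qed

section \<open>Orbits of deck transformations\<close>

lemma deck_groupD:
  assumes "\<phi> \<in> carrier (deck_group G v)"
  shows "\<phi> \<in> Bij (pverts (universal_cover G v))"
    and "u \<in> pverts (universal_cover G v) \<Longrightarrow> \<phi> u \<in> pverts (universal_cover G v)"
    and "u \<in> pverts (universal_cover G v) \<Longrightarrow> cover_proj (\<phi> u) = cover_proj u"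
    and "(u, w) \<in> parcs (universal_cover G v) \<Longrightarrow> (\<phi> u, \<phi> w) \<in> parcs (universal_cover G v)"
proof -
  have "u \<in> pverts (universal_cover G v) \<and> w \<in> pverts (universal_cover G v)"
    if "(u, w) \<in> parcs (universal_cover G v)"
    using that by (auto simp: universal_cover_def)
  with assms show "\<phi> \<in> Bij (pverts (universal_cover G v))"
    and "u \<in> pverts (universal_cover G v) \<Longrightarrow> \<phi> u \<in> pverts (universal_cover G v)"
    and "u \<in> pverts (universal_cover G v) \<Longrightarrow> cover_proj (\<phi> u) = cover_proj u"
    and "(u, w) \<in> parcs (universal_cover G v) \<Longrightarrow> (\<phi> u, \<phi> w) \<in> parcs (universal_cover G v)"
    by (auto simp: deck_group_def graph_automorphisms_def dest: Bij_imp_funcset)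
qed

text \<open>Needed to regard a subgroup of the deck group as a subgroup of all bijections of the
  vertex set.\<close>

lemma subgroup_deck_group:
  "subgroup (carrier (deck_group G v)) (BijGroup (pverts (universal_cover G v)))"
proof (rule subgroup.intro)
  let ?E = "pverts (universal_cover G v)"
  show "carrier (deck_group G v) \<subseteq> carrier (BijGroup ?E)"
    using deck_groupD(1) by (auto simp: BijGroup_def)
  show "\<one>\<^bsub>BijGroup ?E\<^esub> \<in> carrier (deck_group G v)"
    by (simp add: deck_group_def graph_automorphisms_def BijGroup_def id_Bij)
  show "\<phi> \<otimes>\<^bsub>BijGroup ?E\<^esub> \<psi> \<in> carrier (deck_group G v)"
    if "\<phi> \<in> carrier (deck_group G v)" "\<psi> \<in> carrier (deck_group G v)" for \<phi> \<psi>
    using that deck_groupD(2)[OF that(2)]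
    by (simp add: deck_group_def graph_automorphisms_def BijGroup_def compose_Bij compose_eq)
  show "inv\<^bsub>BijGroup ?E\<^esub> \<phi> \<in> carrier (deck_group G v)"
    if \<phi>: "\<phi> \<in> carrier (deck_group G v)" for \<phi>
  proof -
    have bij: "\<phi> \<in> Bij ?E" using \<phi> by (rule deck_groupD)
    have inv: "inv_into ?E \<phi> u \<in> ?E" "\<phi> (inv_into ?E \<phi> u) = u" if "u \<in> ?E" for u
      using bij that by (auto simp: Bij_inv_into_mem Bij_def bij_betw_def f_inv_into_f)
    have "cover_proj (inv_into ?E \<phi> u) = cover_proj u" if "u \<in> ?E" for u
      using deck_groupD(3)[OF \<phi>] inv that by metis
    \<comment> \<open>The arc condition for automorphisms is an equivalence, so it can be read at
      the preimages.\<close>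
    moreover have "(u, w) \<in> parcs (universal_cover G v) \<longleftrightarrow>
        (inv_into ?E \<phi> u, inv_into ?E \<phi> w) \<in> parcs (universal_cover G v)"
      if "u \<in> ?E" "w \<in> ?E" for u w
      using \<phi> inv that by (auto simp: deck_group_def graph_automorphisms_def)
    ultimately show ?thesis
      using bij by (simp add: deck_group_def graph_automorphisms_def inv_BijGroup restrict_inv_into_Bij)
  qed
qed

text \<open>The evaluation action is the inclusion of \<open>S\<close> into the group of bijections,
  which is a homomorphism. This makes the general facts about orbits available.\<close>

lemma group_action_deck_subgroup:
  assumes "subgroup S (deck_group G v)"
  shows "group_action ((deck_group G v)\<lparr>carrier := S\<rparr>) (pverts (universal_cover G v)) (\<lambda>\<phi>. \<phi>)"
proof -
  let ?B = "BijGroup (pverts (universal_cover G v))"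
  have "deck_group G v = ?B\<lparr>carrier := carrier (deck_group G v)\<rparr>"
    by (simp add: deck_group_def)
  then have S: "subgroup S ?B"
    using assms group.incl_subgroup[OF group_BijGroup subgroup_deck_group] by metis
  have "group_hom (?B\<lparr>carrier := S\<rparr>) ?B (\<lambda>\<phi>. \<phi>)"
    using S by (auto simp: group_hom_def group_hom_axioms_def hom_def group_BijGroup
        subgroup.mem_carrier intro: subgroup.subgroup_is_group)
  then show ?thesis
    by (simp add: group_action_def deck_group_def)
qed

context
  fixes G :: "'a pair_pre_digraph" and v :: 'a and S :: "('a vwalk set \<Rightarrow> 'a vwalk set) set"
  assumes S: "subgroup S (deck_group G v)"
begin

lemma cover_orbit_self:
  "u \<in> pverts (universal_cover G v) \<Longrightarrow> u \<in> cover_orbit G v S u"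
  unfolding cover_orbit_def by (rule group_action.orbit_refl[OF group_action_deck_subgroup[OF S]])

lemma cover_orbitE:
  assumes "w \<in> cover_orbit G v S u"
  obtains \<phi> where "\<phi> \<in> S" "\<phi> \<in> carrier (deck_group G v)" "w = \<phi> u"
  using assms subgroup.subset[OF S] by (auto simp: cover_orbit_def orbit_def)

lemma cover_orbit_mem:
  assumes "u \<in> pverts (universal_cover G v)" "w \<in> cover_orbit G v S u"
  shows "w \<in> pverts (universal_cover G v)" "cover_proj w = cover_proj u"
  using assms by (auto elim!: cover_orbitE dest: deck_groupD)

lemma cover_orbit_eq:
  assumes u: "u \<in> pverts (universal_cover G v)" and w: "w \<in> cover_orbit G v S u"
  shows "cover_orbit G v S w = cover_orbit G v S u"
proof -
  note sym = group_action.orbit_sym[OF group_action_deck_subgroup[OF S], folded cover_orbit_def]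
  note trans = group_action.orbit_trans[OF group_action_deck_subgroup[OF S], folded cover_orbit_def]
  have w': "w \<in> pverts (universal_cover G v)" using cover_orbit_mem u w by blast
  have "u \<in> cover_orbit G v S w" using sym u w w' by blast
  then show ?thesis
    using trans cover_orbit_mem u w w' by blast
qed

text \<open>The deck transformation that carries \<open>u\<close> to \<open>u'\<close> carries the
  whole arc along.\<close>

lemma cover_orbit_lift_arc:
  assumes "(u, w) \<in> parcs (universal_cover G v)" "u' \<in> cover_orbit G v S u"
  shows "\<exists>w'\<in>cover_orbit G v S w. (u', w') \<in> parcs (universal_cover G v)"
proof -
  obtain \<phi> where "\<phi> \<in> S" "\<phi> \<in> carrier (deck_group G v)" "u' = \<phi> u"
    using assms(2) by (rule cover_orbitE)
  with assms(1) show ?thesis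
    by (auto simp: cover_orbit_def orbit_def intro!: bexI[of _ "\<phi> w"] deck_groupD(4))
qed

section \<open>The quotient graph, its arcs and its projection\<close>

lemma pverts_cover_quotient:
  "pverts (cover_quotient G v S) = cover_orbit G v S ` pverts (universal_cover G v)"
  by (simp add: cover_quotient_def)

text \<open>An arc of the quotient only promises some pair of representatives. Moving that pair by
  an element of \<open>S\<close> allows the representative of the source to be prescribed.\<close>

lemma cover_quotient_arc_iff:
  assumes u: "u \<in> pverts (universal_cover G v)"
  shows "(cover_orbit G v S u, Y) \<in> parcs (cover_quotient G v S) \<longleftrightarrow>
    (\<exists>w. (u, w) \<in> parcs (universal_cover G v) \<and> Y = cover_orbit G v S w)"
proof
  assume "(cover_orbit G v S u, Y) \<in> parcs (cover_quotient G v S)"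
  then obtain y u' w' where y: "y \<in> pverts (universal_cover G v)" "Y = cover_orbit G v S y"
    and u': "u' \<in> cover_orbit G v S u" and w': "w' \<in> Y"
    and arc: "(u', w') \<in> parcs (universal_cover G v)"
    by (auto simp: cover_quotient_def)
  \<comment> \<open>Membership is reversed so that the arc starting at \<open>u'\<close> can be
    moved to start at \<open>u\<close>.\<close>
  have "u \<in> cover_orbit G v S u'"
    using cover_orbit_eq[OF u u'] cover_orbit_self[OF u] by simp
  then obtain w where w: "w \<in> cover_orbit G v S w'" "(u, w) \<in> parcs (universal_cover G v)"
    using cover_orbit_lift_arc[OF arc] by blast
  have "cover_orbit G v S w' = Y" "w' \<in> pverts (universal_cover G v)"
    using cover_orbit_eq cover_orbit_mem y w' by blast+
  with w show "\<exists>w. (u, w) \<in> parcs (universal_cover G v) \<and> Y = cover_orbit G v S w"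
    using cover_orbit_eq by blast
next
  assume "\<exists>w. (u, w) \<in> parcs (universal_cover G v) \<and> Y = cover_orbit G v S w"
  then obtain w where w: "(u, w) \<in> parcs (universal_cover G v)" "Y = cover_orbit G v S w"
    by blast
  moreover have "w \<in> pverts (universal_cover G v)"
    using w by (simp add: universal_cover_def)
  ultimately show "(cover_orbit G v S u, Y) \<in> parcs (cover_quotient G v S)"
    using u cover_orbit_self by (auto simp: cover_quotient_def)
qed

text \<open>Deck transformations preserve the projection, so it has exactly one value on an orbit
  and \<open>the_elem\<close> returns it.\<close>

lemma quotient_proj_cover_orbit:
  assumes "u \<in> pverts (universal_cover G v)"
  shows "quotient_proj (cover_orbit G v S u) = cover_proj u"
proof -
  have "cover_proj ` cover_orbit G v S u = {cover_proj u}"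
    using cover_orbit_self[OF assms] cover_orbit_mem(2)[OF assms] by blast
  then show ?thesis by (simp add: quotient_proj_def)
qed

text \<open>The facts obtained for \<open>w\<close> are again of the form required of
  \<open>u\<close>, so the rule can be chained to lift walks edge by edge.\<close>

lemma cover_quotient_arcE:
  assumes "(X, Y) \<in> parcs (cover_quotient G v S)" "X = cover_orbit G v S u"
    "u \<in> pverts (universal_cover G v)"
  obtains w where "(u, w) \<in> parcs (universal_cover G v)" "w \<in> pverts (universal_cover G v)"
    "Y = cover_orbit G v S w" "quotient_proj Y = cover_proj w"
proof -
  obtain w where w: "(u, w) \<in> parcs (universal_cover G v)" "Y = cover_orbit G v S w"
    using assms cover_quotient_arc_iff by blast
  moreover have "w \<in> pverts (universal_cover G v)"
    using w(1) by (simp add: universal_cover_def)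
  ultimately show thesis
    using that quotient_proj_cover_orbit by blast
qed

text \<open>Connectedness and symmetry are inherited from the cover through the orbit map.\<close>

lemma loop_graph_cover_quotient:
  assumes G: "loop_graph G" and v: "v \<in> pverts G"
  shows "loop_graph (cover_quotient G v S)"
proof -
  interpret pair_sym_digraph G using G by (simp add: loop_graph_def)
  interpret U: pair_sym_digraph "universal_cover G v"
    by (rule pair_sym_digraph_universal_cover)
  have "graph_morphism (universal_cover G v) (cover_quotient G v S) (cover_orbit G v S)"
    using U.wellformed'(1)
    by (auto simp: graph_morphism_def pverts_cover_quotient cover_quotient_arc_iff)
  then have "connected (with_proj (cover_quotient G v S))"
    by (rule connected_surjective_image[OF connected_universal_cover[OF v]])
      (simp add: pverts_cover_quotient)
  moreover have "pair_sym_digraph (cover_quotient G v S)"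
  proof unfold_locales
    show "symmetric (with_proj (cover_quotient G v S))"
      by (auto simp: symmetric_def sym_def cover_quotient_def dest: U.arcs_symmetric)
  qed (auto simp: cover_quotient_def)
  \<comment> \<open>An existing arc rules out the single isolated vertex: an edge of
    \<open>G\<close> at \<open>v\<close> is lifted to the cover and then projected to the
    quotient.\<close>
  moreover have "parcs (cover_quotient G v S) \<noteq> {}"
  proof -
    have root: "walk_class G [v] \<in> pverts (universal_cover G v)"
      using v by (auto simp: pverts_universal_cover vwalk_def)
    obtain x where "(v, x) \<in> parcs G" using loop_graph_has_neighbour[OF G v] by blast
    then have "(cover_proj (walk_class G [v]), x) \<in> parcs G"
      using v by (simp add: arrow_target_walk_class vwalk_def)
    then obtain \<beta> where "(walk_class G [v], \<beta>) \<in> parcs (universal_cover G v)"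
      using cover_proj_lift[OF root] by blast
    then show ?thesis using cover_quotient_arc_iff[OF root] by blast
  qed
  ultimately show ?thesis by (simp add: loop_graph_def)
qed

section \<open>The covering property of the quotient projection\<close>

lemma homotopy_covering_map_quotient_proj:
  assumes G: "loop_graph G" and v: "v \<in> pverts G"
  shows "homotopy_covering_map (cover_quotient G v S) G quotient_proj"
proof (rule homotopy_covering_mapI)
  interpret pair_sym_digraph G using G by (simp add: loop_graph_def)
  interpret Q: pair_sym_digraph "cover_quotient G v S"
    using loop_graph_cover_quotient[OF G v] by (simp add: loop_graph_def)
  note orbitE = Q.in_arcsD1[unfolded pverts_cover_quotient, THEN imageE]
  note proj = graph_morphism_cover_proj[of v, unfolded graph_morphism_def]
  show "loop_graph (cover_quotient G v S)" using G v by (rule loop_graph_cover_quotient)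
  show "loop_graph G" by fact
  show "graph_morphism (cover_quotient G v S) G quotient_proj"
    unfolding graph_morphism_def
  proof (intro conjI ballI allI impI)
    fix X assume "X \<in> pverts (cover_quotient G v S)"
    then show "quotient_proj X \<in> pverts G"
      using proj by (auto simp: pverts_cover_quotient quotient_proj_cover_orbit)
  next
    fix X Y assume XY: "(X, Y) \<in> parcs (cover_quotient G v S)"
    then obtain u where u: "X = cover_orbit G v S u" "u \<in> pverts (universal_cover G v)"
      by (rule orbitE)
    obtain w where "(u, w) \<in> parcs (universal_cover G v)" "quotient_proj Y = cover_proj w"
      using cover_quotient_arcE[OF XY u] .
    with u proj show "(quotient_proj X, quotient_proj Y) \<in> parcs G"
      by (simp add: quotient_proj_cover_orbit)
  qed
  show "\<exists>Y. (X, Y) \<in> parcs (cover_quotient G v S) \<and> quotient_proj Y = x"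
    if X: "X \<in> pverts (cover_quotient G v S)" and x: "(quotient_proj X, x) \<in> parcs G" for X x
  proof -
    obtain u where u: "X = cover_orbit G v S u" "u \<in> pverts (universal_cover G v)"
      using X by (auto simp: pverts_cover_quotient)
    then obtain w where w: "(u, w) \<in> parcs (universal_cover G v)" "cover_proj w = x"
      using x cover_proj_lift[OF u(2)] by (auto simp: quotient_proj_cover_orbit)
    then have "w \<in> pverts (universal_cover G v)" by (simp add: universal_cover_def)
    with u w show ?thesis
      using cover_quotient_arc_iff quotient_proj_cover_orbit by blast
  qed
  show "Y = Y'"
    if XY: "(X, Y) \<in> parcs (cover_quotient G v S)" "(X, Y') \<in> parcs (cover_quotient G v S)"
      and eq: "quotient_proj Y = quotient_proj Y'" for X Y Y'
  proof -
    obtain u where u: "X = cover_orbit G v S u" "u \<in> pverts (universal_cover G v)"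
      using XY(1) by (rule orbitE)
    \<comment> \<open>Both arcs are lifted to start at the same \<open>u\<close>, where neighbours
      are separated by their projections.\<close>
    show ?thesis
      using cover_quotient_arcE[OF XY(1) u] cover_quotient_arcE[OF XY(2) u] eq
        cover_proj_inj_neighbours by metis
  qed
  show "Z = Z'"
    if XYZ: "(X, Y) \<in> parcs (cover_quotient G v S)" "(Y, Z) \<in> parcs (cover_quotient G v S)"
      and XYZ': "(X, Y') \<in> parcs (cover_quotient G v S)" "(Y', Z') \<in> parcs (cover_quotient G v S)"
      and eq: "quotient_proj Z = quotient_proj Z'" for X Y Z Y' Z'
  proof -
    obtain u where u: "X = cover_orbit G v S u" "u \<in> pverts (universal_cover G v)"
      using XYZ(1) by (rule orbitE)
    obtain w where w: "(u, w) \<in> parcs (universal_cover G v)" "w \<in> pverts (universal_cover G v)"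
      "Y = cover_orbit G v S w"
      using cover_quotient_arcE[OF XYZ(1) u] .
    obtain z where z: "(w, z) \<in> parcs (universal_cover G v)" "Z = cover_orbit G v S z"
      "quotient_proj Z = cover_proj z"
      using cover_quotient_arcE[OF XYZ(2) w(3,2)] .
    obtain w' where w': "(u, w') \<in> parcs (universal_cover G v)" "w' \<in> pverts (universal_cover G v)"
      "Y' = cover_orbit G v S w'"
      using cover_quotient_arcE[OF XYZ'(1) u] .
    obtain z' where z': "(w', z') \<in> parcs (universal_cover G v)" "Z' = cover_orbit G v S z'"
      "quotient_proj Z' = cover_proj z'"
      using cover_quotient_arcE[OF XYZ'(2) w'(3,2)] .
    \<comment> \<open>The two lifted walks share their start \<open>u\<close>, so equal projections
      of their ends force equal ends already in the cover.\<close>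
    have "z = z'"
      using cover_proj_inj_two_steps[OF w(1) z(1) w'(1) z'(1)] z z' eq by simp
    then show ?thesis using z z' by simp
  qed
qed

end

text \<open>The first two conjuncts express that the map is well defined: independence of the
  representative, and agreement of the \<open>the_elem\<close> encoding with the intended
  formula.\<close>

theorem theorem3p30:
  fixes G :: "'a pair_pre_digraph" and v :: 'a
    and S :: "('a vwalk set \<Rightarrow> 'a vwalk set) set"
  assumes "loop_graph G"
    and "v \<in> pverts G"
    and "subgroup S (deck_group G v)"
  shows "(\<forall>u\<in>pverts (universal_cover G v). \<forall>w\<in>pverts (universal_cover G v).
            cover_orbit G v S u = cover_orbit G v S w \<longrightarrow> cover_proj u = cover_proj w) \<and>
         (\<forall>u\<in>pverts (universal_cover G v).
            quotient_proj (cover_orbit G v S u) = cover_proj u) \<and>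
         homotopy_covering_map (cover_quotient G v S) G quotient_proj"
proof (intro conjI ballI impI)
  fix u w assume u: "u \<in> pverts (universal_cover G v)" and w: "w \<in> pverts (universal_cover G v)"
    and "cover_orbit G v S u = cover_orbit G v S w"
  \<comment> \<open>Both sides are the value of \<open>quotient_proj\<close> at the common
    orbit.\<close>
  then show "cover_proj u = cover_proj w"
    using quotient_proj_cover_orbit[OF assms(3)] by metis
next
  fix u assume "u \<in> pverts (universal_cover G v)"
  then show "quotient_proj (cover_orbit G v S u) = cover_proj u"
    by (rule quotient_proj_cover_orbit[OF assms(3)])
next
  show "homotopy_covering_map (cover_quotient G v S) G quotient_proj"
    by (rule homotopy_covering_map_quotient_proj[OF assms(3,1,2)])
qed

end
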